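(* Let $P$ be a finite nonempty poset, let $D$ be a nonempty ideal (downward-closed subset) of $P$, and let $A=\operatorname{Max} D$ be the set of maximal elements of $D$. Then $$\sum_{a\in A}\frac{e(D-a)}{e(D)}\,h_P(a)\ \ge\ |D|-|A|+1 .$$ In particular, $$\max_{a\in\operatorname{Max} D}h_P(a)\ \ge\ |D|-|\operatorname{Max} D|+1 .$$
   Context: A linear extension of a finite poset $Q$ with $n$ elements is an order-preserving bijection $f:Q\to\{1,\dots,n\}$ (i.e. $x<y$ in $Q$ implies $f(x)<f(y)$). $e(Q)$ denotes the number of linear extensions of $Q$, with $e(\varnothing)=1$. For a finite nonempty poset $P$ and $x\in P$, $h_P(x)=\mathbb E[f(x)]$, where $f$ is a uniformly random linear extension of $P$. Subsets of $P$ carry the induced order, and $D-a$ denotes the induced subposet on $D\setminus\{a\}$. *)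

theory Defs
  imports "HOL-Probability.Probability"
begin

text \<open>
  A poset is a carrier set with a reflexive order relation \<open>r\<close>, where \<open>(x, y) \<in> r\<close> means
  \<open>x \<le> y\<close>. The functions below look at \<open>r\<close> only on the given carrier, so for
  \<open>Q \<subseteq> P\<close> they refer to \<open>Q\<close> with the order induced from \<open>P\<close>. Linear extensions are
  extensional functions, so that each one is counted exactly once.
\<close>

definition linear_extensions :: "'a set \<Rightarrow> 'a rel \<Rightarrow> ('a \<Rightarrow> nat) set" where
  "linear_extensions Q r =
     {f \<in> extensional Q. bij_betw f Q {1..card Q} \<and>
        (\<forall>x\<in>Q. \<forall>y\<in>Q. (x, y) \<in> r \<and> x \<noteq> y \<longrightarrow> f x < f y)}"

definition num_linear_extensions :: "'a set \<Rightarrow> 'a rel \<Rightarrow> nat" where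
  "num_linear_extensions Q r = card (linear_extensions Q r)"

definition average_height :: "'a set \<Rightarrow> 'a rel \<Rightarrow> 'a \<Rightarrow> real" where
  "average_height P r x =
     measure_pmf.expectation (pmf_of_set (linear_extensions P r)) (\<lambda>f. real (f x))"

definition order_ideal :: "'a set \<Rightarrow> 'a rel \<Rightarrow> 'a set \<Rightarrow> bool" where
  "order_ideal P r D \<longleftrightarrow> D \<subseteq> P \<and> (\<forall>x\<in>D. \<forall>y\<in>P. (y, x) \<in> r \<longrightarrow> y \<in> D)"

definition maximal_elements :: "'a set \<Rightarrow> 'a rel \<Rightarrow> 'a set" where
  "maximal_elements D r = {a \<in> D. \<forall>y\<in>D. (a, y) \<in> r \<longrightarrow> y = a}"

lemma finite_linear_extensions:
  assumes "finite Q"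
  shows "finite (linear_extensions Q r)"
proof (rule finite_subset)
  show "linear_extensions Q r \<subseteq> Q \<rightarrow>\<^sub>E {1..card Q}"
    by (auto simp: linear_extensions_def PiE_def dest: bij_betwE)
  show "finite (Q \<rightarrow>\<^sub>E {1..card Q})"
    using assms by (simp add: finite_PiE)
qed

lemma num_linear_extensions_empty: "num_linear_extensions {} r = 1"
proof -
  have "linear_extensions {} r = {\<lambda>x. undefined}"
    by (auto simp: linear_extensions_def bij_betw_def)
  then show ?thesis
    by (simp add: num_linear_extensions_def)
qed

lemma linear_extensions_nonempty:
  assumes "finite Q" "Q \<subseteq> P" "partial_order_on P r"
  shows "linear_extensions Q r \<noteq> {}"
  using assms(1,2)
proof (induction "card Q" arbitrary: Q)
  case 0
  then have "(\<lambda>x. undefined) \<in> linear_extensions Q r"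
    by (simp add: linear_extensions_def bij_betw_def)
  then show ?case by blast
next
  case (Suc n)
  have r: "trans r" "antisym r"
    using assms(3) by (auto simp: partial_order_on_def preorder_on_def)
  have "Q \<noteq> {}" using Suc.hyps(2) by auto
  have "\<exists>m\<in>Q. \<forall>x\<in>Q. (m, x) \<in> r \<longrightarrow> m = x"
    using Suc.prems(1) \<open>Q \<noteq> {}\<close>
  proof (induction Q rule: finite_ne_induct)
    case (insert z F)
    then obtain m where m: "m \<in> F" "\<forall>x\<in>F. (m, x) \<in> r \<longrightarrow> m = x" by blast
    show ?case
    proof (cases "(m, z) \<in> r")
      case True
      have "z = x" if "x \<in> F" "(z, x) \<in> r" for x
      proof -
        have "(m, x) \<in> r" using transD[OF r(1) True that(2)] .
        then have "m = x" using m(2) that(1) by blast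
        then show ?thesis using antisymD[OF r(2)] True that(2) by blast
      qed
      then show ?thesis by blast
    next
      case False
      then show ?thesis using m by blast
    qed
  qed simp
  then obtain m where m: "m \<in> Q" "\<forall>x\<in>Q. (m, x) \<in> r \<longrightarrow> m = x" by blast
  have n: "n = card (Q - {m})" using Suc.hyps(2) m(1) Suc.prems(1) by simp
  then have "linear_extensions (Q - {m}) r \<noteq> {}"
    using Suc.hyps(1) Suc.prems by blast
  then obtain f where f: "f \<in> extensional (Q - {m})" "bij_betw f (Q - {m}) {1..n}"
      "\<forall>x\<in>Q - {m}. \<forall>y\<in>Q - {m}. (x, y) \<in> r \<and> x \<noteq> y \<longrightarrow> f x < f y"
    by (auto simp: linear_extensions_def n)
  let ?g = "f(m := Suc n)"
  have "bij_betw ?g (Q - {m}) {1..n}"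
    using f(2) by (subst bij_betw_cong[where g = f]) auto
  then have "bij_betw ?g (insert m (Q - {m})) (insert (?g m) {1..n})"
    by (intro iffD1[OF notIn_Un_bij_betw3[of m "Q - {m}" ?g "{1..n}", simplified Un_insert_right Un_empty_right]]) auto
  moreover have "insert m (Q - {m}) = Q" using m(1) by blast
  moreover have "insert (?g m) {1..n} = {1..card Q}" using Suc.hyps(2) by auto
  ultimately have "bij_betw ?g Q {1..card Q}" by simp
  moreover have "?g \<in> extensional Q" using f(1) m(1) by (auto simp: extensional_def)
  moreover have "?g x < ?g y" if "x \<in> Q" "y \<in> Q" "(x, y) \<in> r" "x \<noteq> y" for x y
  proof -
    have "x \<noteq> m" using m that by blast
    then have "f x \<in> {1..n}" using f(2) that(1) by (auto dest: bij_betwE)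
    then show ?thesis using \<open>x \<noteq> m\<close> f(3) that by auto
  qed
  ultimately have "?g \<in> linear_extensions Q r"
    by (auto simp: linear_extensions_def simp del: fun_upd_apply)
  then show ?case by blast
qed

end

theory Submission
  imports Defs
begin

text \<open>
  Write \<open>w\<^sub>a(D) = e(D - a) / e(D)\<close> for the probability that \<open>a\<close> comes last in a random linear
  extension of \<open>D\<close>, and put \<open>h\<^sub>I(a) = |I| + 1\<close> for an ideal \<open>I\<close> with \<open>a \<notin> I\<close>. By induction on \<open>I\<close>,
  every ideal \<open>I\<close> of \<open>P\<close> satisfies \<open>\<Sum>a\<in>A. w\<^sub>a(D) h\<^sub>I(a) \<ge> |(D - A) \<inter> I| + 1\<close>, and \<open>I = P\<close> is
  the theorem. Conditioning on the last element \<open>m\<close> of a random linear extension of \<open>I\<close> reduces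
  the induction step to \<open>\<Sum>m\<in>Max I \<inter> (D - A). w\<^sub>m(I) \<le> \<Sum>a\<in>A - I. w\<^sub>a(D)\<close>. This follows from
  the monotonicity \<open>w\<^sub>a(D) \<le> w\<^sub>a(E)\<close> for ideals \<open>E \<subseteq> D\<close> applied to \<open>E = D \<inter> I\<close>, which in turn
  is the supermodularity \<open>e(D - a) e(D - v) \<le> e(D) e(D - a - v)\<close>.
\<close>

section \<open>Linear extensions and their last element: recursions and positivity\<close>

lemma finite_maximal_elements: "finite Q \<Longrightarrow> finite (maximal_elements Q r)"
  by (simp add: maximal_elements_def)

lemma linear_extensions_insert_top:
  assumes Q: "finite Q" and m: "m \<in> maximal_elements Q r"
    and g: "g \<in> linear_extensions (Q - {m}) r"
  shows "g(m := card Q) \<in> linear_extensions Q r"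
proof -
  have mQ: "m \<in> Q" and mmax: "\<And>y. y \<in> Q \<Longrightarrow> (m, y) \<in> r \<Longrightarrow> y = m"
    using m by (auto simp: maximal_elements_def)
  have card: "card Q = Suc (card (Q - {m}))"
    using Q mQ by (metis card_Suc_Diff1)
  have bij: "bij_betw g (Q - {m}) {1..card (Q - {m})}"
    and ext: "g \<in> extensional (Q - {m})"
    and ord: "\<And>x y. x \<in> Q - {m} \<Longrightarrow> y \<in> Q - {m} \<Longrightarrow> (x, y) \<in> r \<Longrightarrow> x \<noteq> y \<Longrightarrow> g x < g y"
    using g by (auto simp: linear_extensions_def)
  have le: "g x < card Q" if "x \<in> Q - {m}" for x
  proof -
    have "g x \<le> card (Q - {m})" using bij_betwE[OF bij] that by auto
    then show ?thesis using card by linarith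
  qed
  have "bij_betw (g(m := card Q)) (Q - {m}) {1..card (Q - {m})}"
    using bij by (subst bij_betw_cong[where g = g]) auto
  then have "bij_betw (g(m := card Q)) (Q - {m} \<union> {m}) ({1..card (Q - {m})} \<union> {card Q})"
    by (rule bij_betw_combine) (auto simp: bij_betw_def card)
  moreover have "Q - {m} \<union> {m} = Q" using mQ by auto
  moreover have "{1..card (Q - {m})} \<union> {card Q} = {1..card Q}" using card by auto
  ultimately have "bij_betw (g(m := card Q)) Q {1..card Q}" by simp
  moreover have "g(m := card Q) \<in> extensional Q"
    using ext mQ by (auto simp: extensional_def)
  moreover have "(g(m := card Q)) x < (g(m := card Q)) y"
    if "x \<in> Q" "y \<in> Q" "(x, y) \<in> r" "x \<noteq> y" for x y
    using that mmax[of y] ord[of x y] le[of x] by auto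
  ultimately show ?thesis
    by (auto simp: linear_extensions_def simp del: fun_upd_apply)
qed

lemma linear_extensions_remove_top:
  assumes Q: "finite Q" and f: "f \<in> linear_extensions Q r" and m: "m \<in> Q" "f m = card Q"
  shows "m \<in> maximal_elements Q r"
    and "restrict f (Q - {m}) \<in> linear_extensions (Q - {m}) r"
proof -
  have bij: "bij_betw f Q {1..card Q}"
    and ord: "\<And>x y. x \<in> Q \<Longrightarrow> y \<in> Q \<Longrightarrow> (x, y) \<in> r \<Longrightarrow> x \<noteq> y \<Longrightarrow> f x < f y"
    using f by (auto simp: linear_extensions_def)
  have "f y \<le> f m" if "y \<in> Q" for y
    using bij_betwE[OF bij] that m by auto
  then show "m \<in> maximal_elements Q r"
    using ord[of m] m by (fastforce simp: maximal_elements_def)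
  have "bij_betw f (Q - {m}) ({1..card Q} - {f m})"
    using bij m(1) inj_on_image_set_diff[of f Q Q "{m}"] by (auto simp: bij_betw_def inj_on_diff)
  moreover have "{1..card Q} - {f m} = {1..card (Q - {m})}"
    using m Q by (auto simp: card_Diff_singleton)
  ultimately have "bij_betw (restrict f (Q - {m})) (Q - {m}) {1..card (Q - {m})}"
    by (subst bij_betw_cong[where g = f]) auto
  then show "restrict f (Q - {m}) \<in> linear_extensions (Q - {m}) r"
    using ord by (auto simp: linear_extensions_def)
qed

text \<open>Deleting the element of value \<open>card Q\<close> is a bijection from linear
  extensions of \<open>Q\<close> to pairs of a maximal element \<open>m\<close> and a linear
  extension of \<open>Q - {m}\<close>. Keeping \<open>\<phi>\<close> arbitrary gives the recursions
  for counts and for heights at once.\<close>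

lemma sum_linear_extensions:
  fixes \<phi> :: "('a \<Rightarrow> nat) \<Rightarrow> 'b :: comm_monoid_add"
  assumes Q: "finite Q" "Q \<noteq> {}"
  shows "(\<Sum>f\<in>linear_extensions Q r. \<phi> f) =
    (\<Sum>m\<in>maximal_elements Q r. \<Sum>g\<in>linear_extensions (Q - {m}) r. \<phi> (g(m := card Q)))"
proof -
  define top where "top f = the_inv_into Q f (card Q)" for f :: "'a \<Rightarrow> nat"
  have top: "top f \<in> Q" "f (top f) = card Q"
    "\<And>m. m \<in> Q \<Longrightarrow> f m = card Q \<Longrightarrow> top f = m"
    if "f \<in> linear_extensions Q r" for f
  proof -
    have bij: "inj_on f Q" "f ` Q = {1..card Q}"
      using that by (auto simp: linear_extensions_def bij_betw_def)
    moreover have "card Q \<in> {1..card Q}" using Q by (simp add: Suc_le_eq card_gt_0_iff)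
    ultimately have c: "card Q \<in> f ` Q" by simp
    show "top f \<in> Q" unfolding top_def using bij(1) c by (rule the_inv_into_into) simp
    show "f (top f) = card Q" unfolding top_def using bij(1) c by (rule f_the_inv_into_f)
    show "top f = m" if "m \<in> Q" "f m = card Q" for m
      using bij(1) that by (metis top_def the_inv_into_f_f)
  qed
  have "(\<Sum>f\<in>linear_extensions Q r. \<phi> f) =
    (\<Sum>(m, g)\<in>(SIGMA m:maximal_elements Q r. linear_extensions (Q - {m}) r).
       \<phi> (g(m := card Q)))"
  proof (rule sum.reindex_bij_witness[where
        i = "\<lambda>(m, g). g(m := card Q)" and j = "\<lambda>f. (top f, restrict f (Q - {top f}))"])
    fix f assume f: "f \<in> linear_extensions Q r"
    have ext: "f \<in> extensional Q" using f by (simp add: linear_extensions_def)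
    have eq: "(restrict f (Q - {top f}))(top f := card Q) = f"
    proof
      fix x show "((restrict f (Q - {top f}))(top f := card Q)) x = f x"
        using top(2)[OF f] ext by (auto simp: restrict_def extensional_def)
    qed
    show "(case (top f, restrict f (Q - {top f})) of (m, g) \<Rightarrow> g(m := card Q)) = f"
      using eq by simp
    show "(top f, restrict f (Q - {top f})) \<in> (SIGMA m:maximal_elements Q r. linear_extensions (Q - {m}) r)"
      using linear_extensions_remove_top[OF Q(1) f top(1,2)[OF f]] by auto
    show "(case (top f, restrict f (Q - {top f})) of (m, g) \<Rightarrow> \<phi> (g(m := card Q))) = \<phi> f"
      using eq by simp
  next
    fix p assume "p \<in> (SIGMA m:maximal_elements Q r. linear_extensions (Q - {m}) r)"
    then obtain m g where p: "p = (m, g)" "m \<in> maximal_elements Q r"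
      and g: "g \<in> linear_extensions (Q - {m}) r" by auto
    have mQ: "m \<in> Q" using p(2) by (simp add: maximal_elements_def)
    have L: "g(m := card Q) \<in> linear_extensions Q r"
      using linear_extensions_insert_top[OF Q(1) p(2) g] .
    show "(case p of (m, g) \<Rightarrow> g(m := card Q)) \<in> linear_extensions Q r" using L p by simp
    have t: "top (g(m := card Q)) = m" using top(3)[OF L mQ] by simp
    have "restrict (g(m := card Q)) (Q - {m}) = g"
      using g by (auto simp: linear_extensions_def extensional_def restrict_def fun_eq_iff)
    then show "(top (case p of (m, g) \<Rightarrow> g(m := card Q)),
        restrict (case p of (m, g) \<Rightarrow> g(m := card Q))
          (Q - {top (case p of (m, g) \<Rightarrow> g(m := card Q))})) = p"
      using t p(1) by simp
  qed
  also have "\<dots> = (\<Sum>m\<in>maximal_elements Q r. \<Sum>g\<in>linear_extensions (Q - {m}) r. \<phi> (g(m := card Q)))"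
    using Q(1) by (subst sum.Sigma) (auto intro: finite_linear_extensions finite_maximal_elements)
  finally show ?thesis .
qed

lemma num_linear_extensions_rec:
  assumes "finite Q" "Q \<noteq> {}"
  shows "num_linear_extensions Q r =
    (\<Sum>m\<in>maximal_elements Q r. num_linear_extensions (Q - {m}) r)"
  using sum_linear_extensions[OF assms, where \<phi> = "\<lambda>_. 1 :: nat"]
  by (simp add: num_linear_extensions_def)

text \<open>Elements outside \<open>Q\<close> get height \<open>card Q + 1\<close>, the place that they would take if
  they were to be added on top next; this makes the recursion below uniform in \<open>a\<close>.\<close>

definition total_height :: "'a set \<Rightarrow> 'a rel \<Rightarrow> 'a \<Rightarrow> real" where
  "total_height Q r a =
     (\<Sum>f\<in>linear_extensions Q r. real (if a \<in> Q then f a else card Q + 1))"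

text \<open>For \<open>a = m\<close> the default height in \<open>Q - {m}\<close> is
  \<open>card (Q - {m}) + 1 = card Q\<close>, exactly the height of \<open>a\<close> as last
  element. For \<open>a\<close> outside \<open>Q\<close> the default drops by one when
  \<open>m\<close> is removed, so one unit per linear extension of \<open>Q\<close> must be added
  back.\<close>

lemma total_height_rec:
  assumes Q: "finite Q" "Q \<noteq> {}"
  shows "total_height Q r a = (\<Sum>m\<in>maximal_elements Q r. total_height (Q - {m}) r a)
    + (if a \<in> Q then 0 else real (num_linear_extensions Q r))"
proof -
  have card: "card Q = Suc (card (Q - {m}))" if "m \<in> Q" for m
    using Q(1) that by (metis card_Suc_Diff1)
  show ?thesis
  proof (cases "a \<in> Q")
    case True
    have "total_height Q r a = (\<Sum>m\<in>maximal_elements Q r. \<Sum>g\<in>linear_extensions (Q - {m}) r.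
        real ((g(m := card Q)) a))"
      using sum_linear_extensions[OF Q, where \<phi> = "\<lambda>f. real (f a)"] True
      by (simp add: total_height_def)
    also have "\<dots> = (\<Sum>m\<in>maximal_elements Q r. total_height (Q - {m}) r a)"
      unfolding total_height_def using True card
      by (intro sum.cong refl) (auto simp: maximal_elements_def)
    finally show ?thesis using True by simp
  next
    case False
    have "total_height (Q - {m}) r a = real (num_linear_extensions (Q - {m}) r) * real (card Q)"
      if "m \<in> maximal_elements Q r" for m
      using that card[of m] False
      by (simp add: total_height_def num_linear_extensions_def maximal_elements_def)
    then have "(\<Sum>m\<in>maximal_elements Q r. total_height (Q - {m}) r a)
        = real (num_linear_extensions Q r) * real (card Q)"
      using num_linear_extensions_rec[OF Q, of r] by (simp add: sum_distrib_right)
    then show ?thesis using False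
      by (simp add: total_height_def num_linear_extensions_def algebra_simps)
  qed
qed

lemma average_height_eq_total_height:
  assumes "finite P" "partial_order_on P r" "a \<in> P"
  shows "average_height P r a = total_height P r a / real (num_linear_extensions P r)"
  using finite_linear_extensions[OF assms(1)] linear_extensions_nonempty[OF assms(1) order_refl assms(2)] assms(3)
  by (simp add: average_height_def total_height_def num_linear_extensions_def integral_pmf_of_set)

lemma num_linear_extensions_pos:
  assumes "finite Q" "Q \<subseteq> P" "partial_order_on P r"
  shows "num_linear_extensions Q r > 0"
  using linear_extensions_nonempty[OF assms] finite_linear_extensions[OF assms(1)]
  by (simp add: num_linear_extensions_def card_gt_0_iff)

text \<open>Otherwise the recursion would give a positive count as an empty sum.\<close>

lemma maximal_elements_nonempty:
  assumes "finite Q" "Q \<subseteq> P" "partial_order_on P r" "Q \<noteq> {}"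
  shows "maximal_elements Q r \<noteq> {}"
  using num_linear_extensions_pos[OF assms(1-3)] num_linear_extensions_rec[OF assms(1,4), of r]
  by auto

section \<open>Supermodularity of the number of linear extensions\<close>

text \<open>The last element of an extension of \<open>D - {x}\<close> is \<open>y\<close> or some
  \<open>m\<close> that stays maximal when \<open>y\<close> is removed too. Indexing by the maximal
  elements of \<open>D - {x, y}\<close>, a set symmetric in \<open>x\<close> and \<open>y\<close>,
  allows the expansions for \<open>D - {x}\<close> and \<open>D - {y}\<close> to be compared term by
  term.\<close>

lemma num_linear_extensions_remove_rec:
  assumes D: "finite D" and xy: "x \<in> maximal_elements D r" "y \<in> maximal_elements D r" "x \<noteq> y"
  shows "num_linear_extensions (D - {x}) r = num_linear_extensions (D - {x, y}) r +
    (\<Sum>m\<in>maximal_elements (D - {x, y}) r.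
       if m \<in> maximal_elements (D - {x}) r then num_linear_extensions (D - {x, m}) r else 0)"
proof -
  have y: "y \<in> D - {x}" "y \<in> maximal_elements (D - {x}) r"
    using xy by (auto simp: maximal_elements_def)
  have fin: "finite (maximal_elements (D - {x}) r)" "finite (maximal_elements (D - {x, y}) r)"
    using D by (simp_all add: finite_maximal_elements)
  have eq: "{m \<in> maximal_elements (D - {x, y}) r. m \<in> maximal_elements (D - {x}) r}
      = maximal_elements (D - {x}) r - {y}"
    by (auto simp: maximal_elements_def)
  have "num_linear_extensions (D - {x}) r =
      (\<Sum>m\<in>maximal_elements (D - {x}) r. num_linear_extensions (D - {x, m}) r)"
    using num_linear_extensions_rec[of "D - {x}" r] D y(1)
    by (auto simp: Diff_insert2[symmetric] insert_commute)
  also have "\<dots> = num_linear_extensions (D - {x, y}) r +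
      (\<Sum>m\<in>maximal_elements (D - {x}) r - {y}. num_linear_extensions (D - {x, m}) r)"
    using fin(1) y(2) by (rule sum.remove)
  also have "(\<Sum>m\<in>maximal_elements (D - {x}) r - {y}. num_linear_extensions (D - {x, m}) r) =
      (\<Sum>m\<in>maximal_elements (D - {x, y}) r.
       if m \<in> maximal_elements (D - {x}) r then num_linear_extensions (D - {x, m}) r else 0)"
    using fin(2) by (subst sum.inter_filter[symmetric]) (simp_all add: eq)
  finally show ?thesis .
qed

text \<open>Strong induction on \<open>card D\<close>, with the hypothesis used for three smaller
  sets: \<open>D - {m}\<close> with the pair \<open>a\<close>, \<open>v\<close> bounds
  \<open>e D\<close> from below, while \<open>D - {a}\<close> with \<open>m\<close>,
  \<open>v\<close> and \<open>D - {v}\<close> with \<open>m\<close>, \<open>a\<close> fix the signs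
  of the factors in a sum of products.\<close>

lemma num_linear_extensions_supermodular:
  assumes "finite D" "D \<subseteq> P" "partial_order_on P r"
    and "a \<in> maximal_elements D r" "v \<in> maximal_elements D r" "a \<noteq> v"
  shows "num_linear_extensions (D - {a}) r * num_linear_extensions (D - {v}) r
    \<le> num_linear_extensions D r * num_linear_extensions (D - {a, v}) r"
  using assms(1,2,4-6)
proof (induction "card D" arbitrary: D a v rule: less_induct)
  case less
  define e where "e X = real (num_linear_extensions X r)" for X
  define Q where "Q = D - {a, v}"
  define M where "M = maximal_elements Q r"
  \<comment> \<open>An \<open>m\<close> in \<open>M\<close> may lie below \<open>v\<close>; it is
    then not maximal in \<open>D - {a}\<close> and contributes 0. Likewise for \<open>B\<close> with
    \<open>a\<close> in place of \<open>v\<close>.\<close>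
  define A where "A m = (if m \<in> maximal_elements (D - {a}) r then e (D - {a, m}) else 0)" for m
  define B where "B m = (if m \<in> maximal_elements (D - {v}) r then e (D - {v, m}) else 0)" for m
  have fin: "finite D" "finite Q" "finite M" and "D \<subseteq> P"
    using less.prems by (simp_all add: Q_def M_def finite_maximal_elements)
  have pos: "e X > 0" if "X \<subseteq> D" for X
    using num_linear_extensions_pos[OF _ _ assms(3), of X] that fin(1) \<open>D \<subseteq> P\<close>
    by (auto simp: e_def intro: finite_subset)
  have av: "a \<in> D" "v \<in> D" using less.prems by (auto simp: maximal_elements_def)
  have M: "m \<in> D" "m \<noteq> a" "m \<noteq> v" if "m \<in> M" for m
    using that by (auto simp: M_def Q_def maximal_elements_def)
  have smaller: "card (D - {m}) < card D" if "m \<in> D" for m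
    using that fin(1) by (metis card_Diff1_less)
  have IH: "e (D - {m, x}) * e (D - {m, y}) \<le> e (D - {m}) * e (D - {m, x, y})"
    if "m \<in> D" "x \<in> maximal_elements (D - {m}) r" "y \<in> maximal_elements (D - {m}) r" "x \<noteq> y"
    for m x y
  proof -
    have "num_linear_extensions (D - {m} - {x}) r * num_linear_extensions (D - {m} - {y}) r
      \<le> num_linear_extensions (D - {m}) r * num_linear_extensions (D - {m} - {x, y}) r"
      using less.hyps[OF smaller[OF that(1)] _ _ that(2-4)] fin(1) \<open>D \<subseteq> P\<close> by blast
    moreover have "D - {m} - {x} = D - {m, x}" "D - {m} - {y} = D - {m, y}"
      "D - {m} - {x, y} = D - {m, x, y}" by auto
    ultimately show ?thesis by (simp add: e_def flip: of_nat_mult)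
  qed
  have A: "e (D - {a}) = e Q + sum A M"
    using num_linear_extensions_remove_rec[OF fin(1) less.prems(3,4,5)]
    by (simp add: e_def A_def M_def Q_def of_nat_sum if_distrib[of real] cong: if_cong)
  have "D - {v, a} = Q" by (auto simp: Q_def)
  then have B: "e (D - {v}) = e Q + sum B M"
    using num_linear_extensions_remove_rec[OF fin(1) less.prems(4,3)] less.prems(5)
    by (simp add: e_def B_def M_def of_nat_sum if_distrib[of real] cong: if_cong)
  have D: "e (D - {a}) + e (D - {v}) + (\<Sum>m\<in>M. A m * B m / e (Q - {m})) \<le> e D"
  proof -
    define C where "C = maximal_elements D r - {a, v}"
    have C: "C \<subseteq> M" by (auto simp: C_def M_def Q_def maximal_elements_def)
    \<comment> \<open>Such an \<open>m\<close> is maximal in \<open>Q\<close> but not in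
      \<open>D\<close>, so it lies below \<open>a\<close> or \<open>v\<close>, which makes
      \<open>B m\<close> or \<open>A m\<close> vanish.\<close>
    have zero: "A m * B m / e (Q - {m}) = 0" if "m \<in> M - C" for m
      using that less.prems(5) by (auto simp: A_def B_def C_def M_def Q_def maximal_elements_def)
    have le: "A m * B m / e (Q - {m}) \<le> e (D - {m})" if m: "m \<in> C" for m
    proof -
      have mD: "m \<in> maximal_elements D r" "m \<in> D" "m \<noteq> a" "m \<noteq> v"
        using m by (auto simp: C_def maximal_elements_def)
      have "A m = e (D - {m, a})" "B m = e (D - {m, v})"
        using mD by (auto simp: A_def B_def maximal_elements_def insert_commute)
      moreover have "a \<in> maximal_elements (D - {m}) r" "v \<in> maximal_elements (D - {m}) r"
        using less.prems(3,4) mD by (auto simp: maximal_elements_def)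
      moreover have "Q - {m} = D - {m, a, v}" by (auto simp: Q_def)
      ultimately show ?thesis
        using IH[OF mD(2), of a v] less.prems(5) pos[of "Q - {m}"]
        by (auto simp: divide_le_eq Q_def)
    qed
    have "(\<Sum>m\<in>M. A m * B m / e (Q - {m})) = (\<Sum>m\<in>C. A m * B m / e (Q - {m}))"
      using fin(3) C zero by (intro sum.mono_neutral_right) auto
    also have "\<dots> \<le> (\<Sum>m\<in>C. e (D - {m}))" by (rule sum_mono) (rule le)
    finally have *: "(\<Sum>m\<in>M. A m * B m / e (Q - {m})) \<le> (\<Sum>m\<in>C. e (D - {m}))" .
    have "maximal_elements D r = insert a (insert v C)"
      using less.prems(3,4) by (auto simp: C_def)
    moreover have "a \<notin> insert v C" "v \<notin> C" "finite C"
      using less.prems(5) finite_subset[OF C fin(3)] by (simp_all add: C_def)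
    ultimately have "e D = e (D - {a}) + e (D - {v}) + (\<Sum>m\<in>C. e (D - {m}))"
      using num_linear_extensions_rec[OF fin(1), of r] av
      by (cases "D = {}") (simp_all add: e_def)
    then show ?thesis using * by simp
  qed
  have "e (D - {a}) * e (D - {v}) \<le> e D * e Q"
  proof (cases "Q = {}")
    \<comment> \<open>The recursion for \<open>e Q\<close> needs \<open>Q\<close> nonempty. Here
      \<open>D = {a, v}\<close>, the sums over \<open>M\<close> vanish, and \<open>D\<close> already
      is the claim.\<close>
    case True
    then have "M = {}" by (simp add: M_def maximal_elements_def)
    moreover have "e Q > 0" using pos[of Q] True by simp
    ultimately show ?thesis
      using A B D by (simp add: mult_right_mono)
  next
    case False
    define q where "q m = e (Q - {m})" for m
    let ?a = "e (D - {a})" and ?b = "e (D - {v})"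
    have qpos: "q m > 0" for m using pos[of "Q - {m}"] by (auto simp: q_def Q_def)
    have Qpos: "e Q > 0" using pos[of Q] by (auto simp: Q_def)
    have Q: "e Q = sum q M"
      using num_linear_extensions_rec[OF fin(2) False, of r] by (simp add: e_def q_def M_def of_nat_sum)
    have Aq: "A m * e Q \<le> ?a * q m" if m: "m \<in> M" for m
    proof (cases "m \<in> maximal_elements (D - {a}) r")
      case True
      moreover have "v \<in> maximal_elements (D - {a}) r"
        using less.prems by (auto simp: maximal_elements_def)
      moreover have "D - {a, m, v} = Q - {m}" by (auto simp: Q_def)
      ultimately show ?thesis
        using IH[OF av(1), of m v] M[OF m] by (simp add: A_def q_def Q_def)
    qed (use qpos[of m] pos[of "D - {a}"] in \<open>auto simp: A_def\<close>)
    have Bq: "B m * e Q \<le> ?b * q m" if m: "m \<in> M" for m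
    proof (cases "m \<in> maximal_elements (D - {v}) r")
      case True
      moreover have "a \<in> maximal_elements (D - {v}) r"
        using less.prems by (auto simp: maximal_elements_def)
      moreover have "D - {v, m, a} = Q - {m}" "D - {v, a} = Q" by (auto simp: Q_def)
      ultimately show ?thesis
        using IH[OF av(2), of m a] M[OF m] by (simp add: B_def q_def)
    qed (use qpos[of m] pos[of "D - {v}"] in \<open>auto simp: B_def\<close>)
    \<comment> \<open>By the induction hypothesis both factors are nonnegative; expanding the product and
      summing over \<open>m\<close> turns this into the claim.\<close>
    have "0 \<le> (\<Sum>m\<in>M. (?a * q m - A m * e Q) * (?b * q m - B m * e Q) / q m)"
      using Aq Bq qpos by (intro sum_nonneg divide_nonneg_pos mult_nonneg_nonneg) auto
    also have "\<dots> = (\<Sum>m\<in>M. ?a * ?b * q m - ?a * e Q * B m - ?b * e Q * A m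
        + e Q * e Q * (A m * B m / q m))"
      using qpos by (intro sum.cong refl) (simp add: field_simps less_imp_neq[symmetric])
    also have "\<dots> = ?a * ?b * sum q M - ?a * e Q * sum B M - ?b * e Q * sum A M
        + e Q * e Q * (\<Sum>m\<in>M. A m * B m / q m)"
      by (simp add: sum.distrib sum_subtractf sum_distrib_left)
    \<comment> \<open>Substitutes \<open>sum q M = e Q\<close>, \<open>sum A M = ?a - e Q\<close>
      and \<open>sum B M = ?b - e Q\<close>.\<close>
    also have "\<dots> = e Q * ((?a + ?b + (\<Sum>m\<in>M. A m * B m / q m)) * e Q - ?a * ?b)"
      using A B by (simp add: Q[symmetric] algebra_simps)
    finally have "?a * ?b \<le> (?a + ?b + (\<Sum>m\<in>M. A m * B m / q m)) * e Q"
      using Qpos by (simp add: zero_le_mult_iff)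
    also have "\<dots> \<le> e D * e Q"
      using D Qpos by (intro mult_right_mono) (simp_all add: q_def)
    finally show ?thesis .
  qed
  then show ?case
    by (simp add: e_def Q_def flip: of_nat_mult)
qed

section \<open>Weights of last elements\<close>

text \<open>The elements of \<open>D - E\<close> are removed one at a time. A maximal element
  \<open>v\<close> of \<open>D - E\<close> is maximal in \<open>D\<close> because \<open>E\<close>
  is downward closed, and supermodularity divided by \<open>e(D) e(D - v)\<close> says that removing
  \<open>v\<close> does not decrease the weight of \<open>a\<close>.\<close>

lemma last_element_weight_antimono:
  assumes "finite D" "D \<subseteq> P" "partial_order_on P r" "order_ideal D r E"
    and "a \<in> maximal_elements D r" "a \<in> E"
  shows "real (num_linear_extensions (D - {a}) r) / real (num_linear_extensions D r)
    \<le> real (num_linear_extensions (E - {a}) r) / real (num_linear_extensions E r)"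
  using assms(1,2,4-6)
proof (induction "card D" arbitrary: D rule: less_induct)
  case less
  have ED: "E \<subseteq> D" using less.prems(3) by (simp add: order_ideal_def)
  show ?case
  proof (cases "D = E")
    case False
    then obtain v where v: "v \<in> maximal_elements (D - E) r"
      using maximal_elements_nonempty[of "D - E" P r] less.prems(1,2) ED assms(3) by blast
    then have vD: "v \<in> maximal_elements D r" "v \<in> D" "v \<notin> E"
      using less.prems(3) by (auto simp: maximal_elements_def order_ideal_def)
    then have av: "a \<noteq> v" using less.prems(5) by blast
    have pos: "real (num_linear_extensions X r) > 0" if "X \<subseteq> D" for X
      using num_linear_extensions_pos[OF _ _ assms(3), of X] that less.prems(1,2)
      by (auto intro: finite_subset)
    have "real (num_linear_extensions (D - {a}) r) * real (num_linear_extensions (D - {v}) r)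
      \<le> real (num_linear_extensions D r) * real (num_linear_extensions (D - {v} - {a}) r)"
      using num_linear_extensions_supermodular[OF less.prems(1,2) assms(3) less.prems(4) vD(1) av]
      by (simp add: Diff_insert2[symmetric] insert_commute flip: of_nat_mult)
    then have "real (num_linear_extensions (D - {a}) r) / real (num_linear_extensions D r)
      \<le> real (num_linear_extensions (D - {v} - {a}) r) / real (num_linear_extensions (D - {v}) r)"
      using pos[of D] pos[of "D - {v}"] by (simp add: field_simps)
    also have "\<dots> \<le> real (num_linear_extensions (E - {a}) r) / real (num_linear_extensions E r)"
    proof (rule less.hyps)
      show "card (D - {v}) < card D" using less.prems(1) vD(2) by (metis card_Diff1_less)
      show "order_ideal (D - {v}) r E" using less.prems(3) vD(3) by (auto simp: order_ideal_def)
      show "a \<in> maximal_elements (D - {v}) r"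
        using less.prems(4) av by (auto simp: maximal_elements_def)
    qed (use less.prems in auto)
    finally show ?thesis .
  qed simp
qed

lemma order_ideal_remove_maximal:
  assumes "order_ideal P r I" "m \<in> maximal_elements I r"
  shows "order_ideal P r (I - {m})"
  using assms by (auto simp: order_ideal_def maximal_elements_def)

lemma sum_last_element_weights:
  assumes "finite D" "D \<subseteq> P" "partial_order_on P r" "D \<noteq> {}"
  shows "(\<Sum>a\<in>maximal_elements D r.
    real (num_linear_extensions (D - {a}) r) / real (num_linear_extensions D r)) = 1"
  using num_linear_extensions_rec[OF assms(1,4), of r] num_linear_extensions_pos[OF assms(1-3)]
  by (simp flip: sum_divide_distrib of_nat_sum)

text \<open>A maximal element of \<open>D\<close> lying in \<open>I\<close>, and a maximal element of \<open>I\<close> lying in \<open>D\<close>, are both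
  maximal in \<open>D \<inter> I\<close>, where they have larger weight; the weights there add up to 1.\<close>

lemma last_element_weights_two_ideals:
  assumes P: "finite P" "partial_order_on P r"
    and D: "order_ideal P r D" "D \<noteq> {}" and I: "order_ideal P r I"
  defines "w \<equiv> \<lambda>X a. real (num_linear_extensions (X - {a}) r) / real (num_linear_extensions X r)"
    and "A \<equiv> maximal_elements D r"
  shows "(\<Sum>m\<in>maximal_elements I r \<inter> (D - A). w I m) \<le> (\<Sum>a\<in>A - I. w D a)"
proof -
  let ?E = "D \<inter> I" and ?N = "maximal_elements I r \<inter> (D - A)"
  have sub: "D \<subseteq> P" "I \<subseteq> P" using D I by (auto simp: order_ideal_def)
  then have fin: "finite D" "finite I" using P(1) by (auto intro: finite_subset)
  then have finA: "finite A" "finite ?N" by (simp_all add: A_def finite_maximal_elements)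
  have ideals: "order_ideal D r ?E" "order_ideal I r ?E"
    using D(1) I by (auto simp: order_ideal_def)
  \<comment> \<open>Rewrites the right-hand side as 1 minus a sum over \<open>A \<inter> I\<close>,
    so that it suffices to bound a sum of weights over two disjoint sets by 1.\<close>
  have total: "(\<Sum>a\<in>A - I. w D a) + (\<Sum>a\<in>A \<inter> I. w D a) = 1"
    using sum_last_element_weights[OF fin(1) sub(1) P(2) D(2)] sum.Int_Diff[OF finA(1), of "w D" I]
    by (simp add: w_def A_def)
  have "(\<Sum>a\<in>A \<inter> I. w D a) + (\<Sum>m\<in>?N. w I m) \<le> (\<Sum>a\<in>A \<inter> I. w ?E a) + (\<Sum>m\<in>?N. w ?E m)"
  proof (intro add_mono sum_mono)
    fix a assume "a \<in> A \<inter> I"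
    then show "w D a \<le> w ?E a"
      using last_element_weight_antimono[OF fin(1) sub(1) P(2) ideals(1), of a]
      by (auto simp: A_def w_def maximal_elements_def)
  next
    fix m assume "m \<in> ?N"
    then show "w I m \<le> w ?E m"
      using last_element_weight_antimono[OF fin(2) sub(2) P(2) ideals(2), of m]
      by (auto simp: w_def maximal_elements_def)
  qed
  also have "\<dots> = (\<Sum>m\<in>(A \<inter> I) \<union> ?N. w ?E m)"
    using finA by (subst sum.union_disjoint) auto
  also have "\<dots> \<le> (\<Sum>m\<in>maximal_elements ?E r. w ?E m)"
    using fin by (intro sum_mono2 finite_maximal_elements) (auto simp: A_def w_def maximal_elements_def)
  \<comment> \<open>Only an inequality: the sum is 0 when \<open>D\<close> and \<open>I\<close> are
    disjoint.\<close>
  also have "\<dots> \<le> 1"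
  proof (cases "?E = {}")
    case True
    then show ?thesis by (simp add: maximal_elements_def)
  next
    case False
    then show ?thesis
      using sum_last_element_weights[of ?E P r] fin(1) le_infI1[OF sub(1)] P(2) by (simp add: w_def)
  qed
  finally show ?thesis using total by simp
qed

section \<open>Induction over ideals and the final bound\<close>

text \<open>Multiplying by \<open>e(I)\<close> replaces averages by total heights, whose recursion
  is additive. At \<open>I = {}\<close> equality holds since the weights sum to 1. In the induction
  step, removing an \<open>m\<close> in \<open>D - A\<close> lowers the count by one, and this loss
  is paid for by the extra term of \<open>total_height_rec\<close> for each \<open>a\<close> outside
  \<open>I\<close>.\<close>

lemma weighted_total_height_ge:
  assumes P: "finite P" "partial_order_on P r"
    and D: "order_ideal P r D" "D \<noteq> {}" and "order_ideal P r I"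
  defines "w \<equiv> \<lambda>X a. real (num_linear_extensions (X - {a}) r) / real (num_linear_extensions X r)"
    and "A \<equiv> maximal_elements D r"
  shows "real (num_linear_extensions I r) * (real (card ((D - A) \<inter> I)) + 1)
    \<le> (\<Sum>a\<in>A. w D a * total_height I r a)"
  using assms(5)
proof (induction "card I" arbitrary: I rule: less_induct)
  case less
  let ?e = "\<lambda>X. real (num_linear_extensions X r)" and ?c = "\<lambda>X. real (card ((D - A) \<inter> X))"
  have sub: "D \<subseteq> P" "I \<subseteq> P" using D less.prems by (auto simp: order_ideal_def)
  then have fin: "finite D" "finite I" using P(1) by (auto intro: finite_subset)
  have finA: "finite A" using fin(1) by (simp add: A_def finite_maximal_elements)
  have total: "sum (w D) A = 1"
    using sum_last_element_weights[OF fin(1) sub(1) P(2) D(2)] by (simp add: w_def A_def)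
  show ?case
  proof (cases "I = {}")
    case True
    have "total_height {} r a = 1" for a
      using num_linear_extensions_empty[of r]
      by (simp add: total_height_def num_linear_extensions_def)
    then show ?thesis using True total num_linear_extensions_empty[of r] by simp
  next
    case False
    define M where "M = maximal_elements I r"
    have M: "finite M" "M \<subseteq> I"
      using fin(2) by (auto simp: M_def maximal_elements_def)
    have eI: "?e I > 0" using num_linear_extensions_pos[OF fin(2) sub(2) P(2)] by simp
    have sumM: "?e I = (\<Sum>m\<in>M. ?e (I - {m}))"
      using num_linear_extensions_rec[OF fin(2) False, of r] by (simp add: M_def)
    \<comment> \<open>The left side is the total loss, the bound in \<open>key\<close> the total
      gain.\<close>
    have "(\<Sum>m\<in>M \<inter> (D - A). ?e (I - {m})) = ?e I * (\<Sum>m\<in>M \<inter> (D - A). w I m)"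
      using eI by (simp add: w_def sum_distrib_left)
    also have "\<dots> \<le> ?e I * (\<Sum>a\<in>A - I. w D a)"
      using last_element_weights_two_ideals[OF P D less.prems] eI
      by (simp add: w_def A_def M_def)
    finally have key: "(\<Sum>m\<in>M \<inter> (D - A). ?e (I - {m})) \<le> ?e I * (\<Sum>a\<in>A - I. w D a)" .
    \<comment> \<open>The induction hypothesis restated with the count for \<open>I\<close>, so that
      its main term sums over \<open>m\<close> to the left-hand side for \<open>I\<close>.\<close>
    have IH: "?e (I - {m}) * (?c I + 1) - (if m \<in> D - A then ?e (I - {m}) else 0)
        \<le> (\<Sum>a\<in>A. w D a * total_height (I - {m}) r a)" if m: "m \<in> M" for m
    proof -
      have "?e (I - {m}) * (?c (I - {m}) + 1) \<le> (\<Sum>a\<in>A. w D a * total_height (I - {m}) r a)"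
      proof (rule less.hyps)
        show "card (I - {m}) < card I" using fin(2) M(2) m by (metis card_Diff1_less subsetD)
        show "order_ideal P r (I - {m})"
          using order_ideal_remove_maximal[OF less.prems] m by (simp add: M_def)
      qed
      moreover have "?c I = ?c (I - {m}) + (if m \<in> D - A then 1 else 0)"
      proof (cases "m \<in> D - A")
        case True
        then have "(D - A) \<inter> I = insert m ((D - A) \<inter> (I - {m}))" using m M(2) by auto
        then show ?thesis using True fin(2) by simp
      next
        case False
        then have "(D - A) \<inter> I = (D - A) \<inter> (I - {m})" by auto
        then show ?thesis using False by simp
      qed
      ultimately show ?thesis by (auto simp: algebra_simps)
    qed
    have "?e I * (?c I + 1) = (\<Sum>m\<in>M. ?e (I - {m}) * (?c I + 1))"
      by (simp add: sumM sum_distrib_right)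
    also have "\<dots> = (\<Sum>m\<in>M. ?e (I - {m}) * (?c I + 1) - (if m \<in> D - A then ?e (I - {m}) else 0))
        + (\<Sum>m\<in>M \<inter> (D - A). ?e (I - {m}))"
      using M(1) by (simp add: sum_subtractf sum.inter_restrict)
    also have "\<dots> \<le> (\<Sum>m\<in>M. \<Sum>a\<in>A. w D a * total_height (I - {m}) r a) + ?e I * (\<Sum>a\<in>A - I. w D a)"
      using IH key by (intro add_mono sum_mono) auto
    also have "\<dots> = (\<Sum>a\<in>A. w D a * (\<Sum>m\<in>M. total_height (I - {m}) r a))
        + (\<Sum>a\<in>A. w D a * (if a \<in> I then 0 else ?e I))"
    proof -
      have "?e I * (\<Sum>a\<in>A - I. w D a) = (\<Sum>a\<in>A. w D a * (if a \<in> I then 0 else ?e I))"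
        using finA by (simp add: sum_distrib_left mult.commute if_distrib sum.If_cases Diff_eq cong: if_cong)
      then show ?thesis by (subst sum.swap) (simp add: sum_distrib_left)
    qed
    also have "\<dots> = (\<Sum>a\<in>A. w D a * total_height I r a)"
      using total_height_rec[OF fin(2) False, of r]
      by (simp add: M_def sum.distrib[symmetric] distrib_left)
    finally show ?thesis .
  qed
qed

theorem theorem4p1:
  fixes P D A :: "'a set" and r :: "'a rel"
  assumes "finite P" and "P \<noteq> {}" and "partial_order_on P r"
    and "order_ideal P r D" and "D \<noteq> {}"
    and "A = maximal_elements D r"
  shows "(\<Sum>a\<in>A. real (num_linear_extensions (D - {a}) r) / real (num_linear_extensions D r)
              * average_height P r a)
           \<ge> real (card D) - real (card A) + 1
       \<and> (MAX a\<in>maximal_elements D r. average_height P r a)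
           \<ge> real (card D) - real (card (maximal_elements D r)) + 1"
proof -
  define w where "w a = real (num_linear_extensions (D - {a}) r) / real (num_linear_extensions D r)" for a
  let ?e = "real (num_linear_extensions P r)"
  have DP: "D \<subseteq> P" and AD: "A \<subseteq> D" and fin: "finite D" "finite A"
    using assms(1,4,6)
    by (auto simp: order_ideal_def maximal_elements_def intro: finite_subset)
  have e: "?e > 0" using num_linear_extensions_pos[OF assms(1) order_refl assms(3)] by simp
  have "order_ideal P r P" by (simp add: order_ideal_def)
  from weighted_total_height_ge[OF assms(1,3-5) this]
  have "?e * (real (card ((D - A) \<inter> P)) + 1) \<le> (\<Sum>a\<in>A. w a * total_height P r a)"
    by (simp add: w_def assms(6))
  also have "\<dots> = ?e * (\<Sum>a\<in>A. w a * average_height P r a)"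
    using average_height_eq_total_height[OF assms(1,3)] AD DP e
    by (auto simp: sum_distrib_left intro!: sum.cong)
  finally have "real (card ((D - A) \<inter> P)) + 1 \<le> (\<Sum>a\<in>A. w a * average_height P r a)"
    using e by simp
  moreover have "(D - A) \<inter> P = D - A" using DP by auto
  moreover have "real (card (D - A)) = real (card D) - real (card A)"
    using fin AD card_mono[OF fin(1) AD] by (simp add: card_Diff_subset of_nat_diff)
  ultimately have main: "real (card D) - real (card A) + 1 \<le> (\<Sum>a\<in>A. w a * average_height P r a)"
    by simp
  \<comment> \<open>The weights are nonnegative and sum to 1, so the weighted average is at most the
    maximum.\<close>
  also have "\<dots> \<le> (\<Sum>a\<in>A. w a * (MAX a\<in>A. average_height P r a))"
    using fin by (intro sum_mono mult_left_mono) (auto simp: w_def)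
  also have "\<dots> = (MAX a\<in>A. average_height P r a)"
    using sum_last_element_weights[OF fin(1) DP assms(3,5)]
    by (simp add: w_def[symmetric] assms(6)[symmetric] sum_distrib_right[symmetric])
  finally show ?thesis using main assms(6) by (simp add: w_def)
qed

end
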